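(* Let $k\ge2$ be an integer and let $\mu=\sum_{i,j\in\mathbb{Z}_k}\alpha_{i,j}\widetilde d_{i,j}+\sum_{r,s\in\mathbb{Z}_k}\kappa_{r,s}\widetilde e_{r,s}$ be a state on the Sekine quantum group algebra $\mathcal{A}_k$. If $\alpha_{0,0}>0$, then the sequence of convolution powers $\{\mu^{\star n}\}_{n\ge1}$ converges (in the finite-dimensional dual space $\mathcal{A}_k'$).
   Context: Fix an integer $k\ge2$, let $\eta=e^{2\pi i/k}$ and $\mathbb{Z}_k=\{0,1,\dots,k-1\}$ (the cyclic group of order $k$; all indices are taken modulo $k$). The Sekine quantum group: $\mathcal{A}_k:=\bigoplus_{i,j\in\mathbb{Z}_k}\mathbb{C}d_{i,j}\oplus M_k(\mathbb{C})$ (the finite-dimensional C*-algebra in which each $d_{i,j}$ is the unit of a copy of $\mathbb{C}$), with matrix units $e_{i,j}$, $i,j\in\mathbb{Z}_k$, of $M_k(\mathbb{C})$, and comultiplication $\Delta_k:\mathcal{A}_k\to\mathcal{A}_k\otimes\mathcal{A}_k$ given by $$\Delta_k(d_{i,j})=\sum_{m,n\in\mathbb{Z}_k}d_{m,n}\otimes d_{i-m,j-n}+\frac1k\sum_{m,n\in\mathbb{Z}_k}\eta^{i(m-n)}e_{m,n}\otimes e_{m+j,n+j},$$ $$\Delta_k(e_{i,j})=\sum_{m,n\in\mathbb{Z}_k}\eta^{m(i-j)}d_{-m,-n}\otimes e_{i-n,j-n}+\sum_{m,n\in\mathbb{Z}_k}\eta^{m(j-i)}e_{i-n,j-n}\otimes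 d_{m,n}.$$ The functionals $\widetilde d_{i,j},\widetilde e_{r,s}$ form the basis of the dual space $\mathcal{A}_k'$ dual to the basis $\{d_{i,j}\}\cup\{e_{r,s}\}$ of $\mathcal{A}_k$ (so $\mu(d_{i,j})=\alpha_{i,j}$ and $\mu(e_{r,s})=\kappa_{r,s}$). A state is a positive linear functional $\mu$ with $\mu(1)=1$. The convolution of $\mu,\nu\in\mathcal{A}_k'$ is $\mu\star\nu:=(\mu\otimes\nu)\Delta_k$, and $\mu^{\star n}$ is the $n$-fold convolution of $\mu$ with itself. *)

theory Defs
  imports
    "HOL-Analysis.Analysis"
    "HOL-Library.Complex_Order"
    "Berlekamp_Zassenhaus.Finite_Field"
begin

text \<open>
  The integer \<open>k \<ge> 2\<close> is the cardinality of a type \<open>'k\<close> of class \<^class>\<open>nontriv\<close>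
  (which says \<open>CARD('k) > 1\<close>), and \<open>'k mod_ring\<close> is the ring of integers modulo \<open>k\<close>,
  so that index arithmetic is automatically taken modulo \<open>k\<close>.

  The algebra is the direct sum of the functions on \<open>\<int>\<^sub>k \<times> \<int>\<^sub>k\<close> and the \<open>k \<times> k\<close> matrices.
\<close>

type_synonym 'k sekine =
  "(complex ^ ('k mod_ring \<times> 'k mod_ring)) \<times> (complex ^ 'k mod_ring ^ 'k mod_ring)"

definition sek_scale :: "complex \<Rightarrow> 'k::nontriv sekine \<Rightarrow> 'k sekine" where
  "sek_scale c a = (c *s fst a, \<chi> i. c *s (snd a $ i))"

text \<open>The product \<open>*\<close> of vectors below is the componentwise one.\<close>

definition sek_mult :: "'k::nontriv sekine \<Rightarrow> 'k sekine \<Rightarrow> 'k sekine" where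
  "sek_mult a b = (fst a * fst b, snd a ** snd b)"

definition sek_one :: "'k::nontriv sekine" where
  "sek_one = (1, mat 1)"

definition sek_star :: "'k::nontriv sekine \<Rightarrow> 'k sekine" where
  "sek_star a = (\<chi> p. cnj (fst a $ p), \<chi> i j. cnj (snd a $ j $ i))"

definition sek_d :: "'k::nontriv mod_ring \<Rightarrow> 'k mod_ring \<Rightarrow> 'k sekine" where
  "sek_d i j = (axis (i, j) 1, 0)"

definition sek_e :: "'k::nontriv mod_ring \<Rightarrow> 'k mod_ring \<Rightarrow> 'k sekine" where
  "sek_e i j = (0, axis i (axis j 1))"

definition dual_d :: "'k::nontriv mod_ring \<Rightarrow> 'k mod_ring \<Rightarrow> 'k sekine \<Rightarrow> complex" where
  "dual_d i j a = fst a $ (i, j)"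

definition dual_e :: "'k::nontriv mod_ring \<Rightarrow> 'k mod_ring \<Rightarrow> 'k sekine \<Rightarrow> complex" where
  "dual_e r s a = snd a $ r $ s"

text \<open>The basis indexed by one type: \<open>Inl (i, j)\<close> stands for \<open>d\<^sub>i\<^sub>j\<close> and \<open>Inr (i, j)\<close> for \<open>e\<^sub>i\<^sub>j\<close>.\<close>

type_synonym 'k sek_idx = "('k mod_ring \<times> 'k mod_ring) + ('k mod_ring \<times> 'k mod_ring)"

definition sek_basis :: "'k::nontriv sek_idx \<Rightarrow> 'k sekine" where
  "sek_basis p = (case p of Inl (i, j) \<Rightarrow> sek_d i j | Inr (i, j) \<Rightarrow> sek_e i j)"

definition sek_coord :: "'k::nontriv sek_idx \<Rightarrow> 'k sekine \<Rightarrow> complex" where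
  "sek_coord p = (case p of Inl (i, j) \<Rightarrow> dual_d i j | Inr (i, j) \<Rightarrow> dual_e i j)"

text \<open>
  The tensor square of the algebra, in coordinates with respect to the basis
  \<open>sek_basis p \<otimes> sek_basis q\<close>. Accordingly, \<open>tensor_fun \<mu> \<nu>\<close> is the linear functional
  \<open>\<mu> \<otimes> \<nu>\<close> (see the lemma \<open>tensor_fun_sek_tensor\<close> below).
\<close>

type_synonym 'k sekine2 = "complex ^ ('k sek_idx \<times> 'k sek_idx)"

definition sek_tensor :: "'k::nontriv sekine \<Rightarrow> 'k sekine \<Rightarrow> 'k sekine2" where
  "sek_tensor a b = (\<chi> pq. sek_coord (fst pq) a * sek_coord (snd pq) b)"

definition tensor_fun ::
  "('k::nontriv sekine \<Rightarrow> complex) \<Rightarrow> ('k sekine \<Rightarrow> complex) \<Rightarrow> 'k sekine2 \<Rightarrow> complex" where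
  "tensor_fun \<mu> \<nu> t = (\<Sum>p\<in>UNIV. \<Sum>q\<in>UNIV. t $ (p, q) * (\<mu> (sek_basis p) * \<nu> (sek_basis q)))"

text \<open>\<open>eta_pow x\<close> is \<open>\<eta>\<close> to the power \<open>x\<close>, where \<open>\<eta> = exp (2 * pi * \<i> / k)\<close> and \<open>x\<close> is a
  residue modulo \<open>k\<close> (computed with the representative of \<open>x\<close> in \<open>{0..<k}\<close>).\<close>

definition eta_pow :: "'k::nontriv mod_ring \<Rightarrow> complex" where
  "eta_pow x = exp (2 * of_real pi * \<i> / of_nat CARD('k)) powi to_int_mod_ring x"

definition delta_d :: "'k::nontriv mod_ring \<Rightarrow> 'k mod_ring \<Rightarrow> 'k sekine2" where
  "delta_d i j =
     (\<Sum>m\<in>UNIV. \<Sum>n\<in>UNIV. sek_tensor (sek_d m n) (sek_d (i - m) (j - n)))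
     + (1 / of_nat CARD('k)) *s
       (\<Sum>m\<in>UNIV. \<Sum>n\<in>UNIV. eta_pow (i * (m - n)) *s sek_tensor (sek_e m n) (sek_e (m + j) (n + j)))"

definition delta_e :: "'k::nontriv mod_ring \<Rightarrow> 'k mod_ring \<Rightarrow> 'k sekine2" where
  "delta_e i j =
     (\<Sum>m\<in>UNIV. \<Sum>n\<in>UNIV. eta_pow (m * (i - j)) *s sek_tensor (sek_d (- m) (- n)) (sek_e (i - n) (j - n)))
     + (\<Sum>m\<in>UNIV. \<Sum>n\<in>UNIV. eta_pow (m * (j - i)) *s sek_tensor (sek_e (i - n) (j - n)) (sek_d m n))"

definition sek_comult :: "'k::nontriv sekine \<Rightarrow> 'k sekine2" where
  "sek_comult a =
     (\<Sum>i\<in>UNIV. \<Sum>j\<in>UNIV. dual_d i j a *s delta_d i j)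
     + (\<Sum>i\<in>UNIV. \<Sum>j\<in>UNIV. dual_e i j a *s delta_e i j)"

text \<open>
  The dual space. It is finite-dimensional, so that all its Hausdorff vector space topologies
  (norm topology, pointwise convergence) coincide; the type of functions on the algebra carries
  the product topology, whose restriction to the dual space is the one of pointwise convergence.
\<close>

definition sek_dual :: "('k::nontriv sekine \<Rightarrow> complex) set" where
  "sek_dual = {\<mu>. Vector_Spaces.linear sek_scale (*) \<mu>}"

text \<open>The order on \<^typ>\<open>complex\<close> is the one of \<^theory>\<open>HOL-Library.Complex_Order\<close>:
  \<open>0 \<le> z\<close> means that \<open>z\<close> is a nonnegative real number.\<close>

definition sek_state :: "('k::nontriv sekine \<Rightarrow> complex) \<Rightarrow> bool" where
  "sek_state \<mu> \<longleftrightarrow> \<mu> \<in> sek_dual \<and> (\<forall>a. 0 \<le> \<mu> (sek_mult (sek_star a) a)) \<and> \<mu> sek_one = 1"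

definition sek_conv ::
  "('k::nontriv sekine \<Rightarrow> complex) \<Rightarrow> ('k sekine \<Rightarrow> complex) \<Rightarrow> 'k sekine \<Rightarrow> complex" where
  "sek_conv \<mu> \<nu> = (\<lambda>a. tensor_fun \<mu> \<nu> (sek_comult a))"

text \<open>The \<open>n\<close>-fold convolution power, meaningful for \<open>n \<ge> 1\<close> only.\<close>

definition sek_conv_pow :: "('k::nontriv sekine \<Rightarrow> complex) \<Rightarrow> nat \<Rightarrow> 'k sekine \<Rightarrow> complex" where
  "sek_conv_pow \<mu> n = ((\<lambda>\<nu>. sek_conv \<nu> \<mu>) ^^ (n - 1)) \<mu>"

lemma sek_conv_pow_1: "sek_conv_pow \<mu> (Suc 0) = \<mu>"
  by (simp add: sek_conv_pow_def)

lemma sek_conv_pow_Suc: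
  "n \<ge> 1 \<Longrightarrow> sek_conv_pow \<mu> (Suc n) = sek_conv (sek_conv_pow \<mu> n) \<mu>"
  by (cases n) (simp_all add: sek_conv_pow_def)

lemma vector_space_sek_scale: "vector_space (sek_scale :: complex \<Rightarrow> 'k::nontriv sekine \<Rightarrow> _)"
  by unfold_locales (auto simp: sek_scale_def prod_eq_iff vec_eq_iff algebra_simps)

lemma vector_space_complex_mult: "vector_space ((*) :: complex \<Rightarrow> complex \<Rightarrow> complex)"
  by unfold_locales (auto simp: algebra_simps)

lemma sek_coord_basis: "sek_coord p (sek_basis q) = (if p = q then 1 else 0)"
  by (auto simp: sek_coord_def sek_basis_def dual_d_def dual_e_def sek_d_def sek_e_def axis_def
      split: sum.splits)

lemma sek_eqI:
  assumes "\<And>p. sek_coord p a = sek_coord p b"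
  shows "a = b"
  using assms[of "Inl _"] assms[of "Inr _"]
  by (simp add: prod_eq_iff vec_eq_iff sek_coord_def dual_d_def dual_e_def split_paired_all)

lemma sek_coord_add: "sek_coord p (a + b) = sek_coord p a + sek_coord p b"
  by (auto simp: sek_coord_def dual_d_def dual_e_def split: sum.splits)

lemma sek_coord_scale: "sek_coord p (sek_scale c a) = c * sek_coord p a"
  by (auto simp: sek_coord_def dual_d_def dual_e_def sek_scale_def split: sum.splits)

lemma sek_coord_zero: "sek_coord p 0 = 0"
  by (auto simp: sek_coord_def dual_d_def dual_e_def split: sum.splits)

lemma sek_coord_sum: "sek_coord p (\<Sum>x\<in>A. f x) = (\<Sum>x\<in>A. sek_coord p (f x))"
  by (induction A rule: infinite_finite_induct) (simp_all add: sek_coord_zero sek_coord_add)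

lemma sek_expand: "a = (\<Sum>p\<in>UNIV. sek_scale (sek_coord p a) (sek_basis p))"
  by (rule sek_eqI)
    (simp add: sek_coord_sum sek_coord_scale sek_coord_basis if_distrib cong: if_cong)

lemma sek_dual_expand:
  assumes "\<mu> \<in> sek_dual"
  shows "\<mu> a = (\<Sum>p\<in>UNIV. sek_coord p a * \<mu> (sek_basis p))"
proof -
  interpret Vector_Spaces.linear sek_scale "(*)" \<mu>
    using assms by (simp add: sek_dual_def)
  show ?thesis
    by (subst sek_expand[of a]) (simp add: sum scale)
qed

lemma tensor_fun_sek_tensor:
  assumes "\<mu> \<in> sek_dual" "\<nu> \<in> sek_dual"
  shows "tensor_fun \<mu> \<nu> (sek_tensor a b) = \<mu> a * \<nu> b"
  unfolding sek_dual_expand[OF assms(1), of a] sek_dual_expand[OF assms(2), of b]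
  by (simp add: tensor_fun_def sek_tensor_def sum_product mult_ac)

end

theory Submission
  imports Defs
begin

text \<open>
  Why the powers converge. Write \<open>a = \<mu> (sek_d 0 0)\<close>. The functional dual to \<open>d\<^sub>0\<^sub>0\<close> is the counit,
  so that right convolution by \<open>\<mu>\<close> is \<open>T = a I + R\<close>, where \<open>R\<close> is right convolution by the
  positive functional \<open>\<mu> - a \<epsilon>\<close> of total mass \<open>1 - a\<close>. In a suitable Hilbert norm such an \<open>R\<close> has norm
  at most \<open>1 - a\<close>. The operator \<open>T\<close> is thus an averaged contraction: a positive amount of the
  identity is mixed in, which rules out eigenvalues of modulus one other than \<open>1\<close>, and
  the powers of \<open>T\<close> converge (lemmas \<open>averaged_contraction_norm\<close> and
  \<open>convergent_funpow_averaged\<close>). Instead of spectral theory, the parallelogram law gives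
  \<open>T u\<^sub>n - u\<^sub>n \<longlonglongrightarrow> 0\<close> along every orbit, so that a limit point of the orbit is a
  fixed point, and the distance to a fixed point decreases.

  The norm comes from a Fourier transform in the first index of the coefficients
  \<open>\<phi> (sek_d i j)\<close>. For each frequency \<open>l\<close>, the transformed coefficients together with the \<open>l\<close>-th
  diagonal of the matrix \<open>\<phi> (sek_e r s)\<close> form a vector \<open>sek_block l \<phi>\<close> indexed by two copies of
  \<open>\<int>\<^sub>k\<close>, that is, by the dihedral group of order \<open>2 k\<close>. The blocks determine \<open>\<phi>\<close> by Fourier
  inversion, and the lemma \<open>sek_block_conv\<close> shows that in each block convolution becomes that of
  the dihedral group: a combination of permutations of the coordinates, with the entries of
  \<open>sek_block l \<mu>\<close> as coefficients. Permutations are isometries of the \<open>\<ell>\<^sup>2\<close>-norm, so the norm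
  of such an operator is at most the \<open>\<ell>\<^sup>1\<close>-norm of the coefficients. For a state, positivity
  bounds an off-diagonal entry of the matrix part by the mean of two diagonal ones, hence every
  diagonal by the trace. Splitting off the term \<open>a I\<close> therefore leaves coefficients of
  \<open>\<ell>\<^sup>1\<close>-norm at most \<open>1 - a\<close> (lemma \<open>sek_state_block_norm_le\<close>).
\<close>

section \<open>Powers of averaged contractions\<close>

text \<open>
  With \<open>y = (1 - c) z\<close> and \<open>norm z \<le> norm x\<close> this follows from the identity
  \<open>|c x + (1 - c) z|\<^sup>2 = c |x|\<^sup>2 + (1 - c) |z|\<^sup>2 - c (1 - c) |x - z|\<^sup>2\<close>. Stating it for \<open>y\<close> avoids dividing by
  \<open>1 - c\<close>, which may vanish. The gain \<open>c |c x + y - x|\<^sup>2\<close> makes the displacements along an orbit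
  square-summable.
\<close>
lemma averaged_contraction_norm:
  fixes x y :: "'a::real_inner"
  assumes "0 \<le> c" "c \<le> 1" "norm y \<le> (1 - c) * norm x"
  shows "(norm (c *\<^sub>R x + y))\<^sup>2 + c * (norm (c *\<^sub>R x + y - x))\<^sup>2 \<le> (norm x)\<^sup>2"
proof -
  define X where "X = (norm x)\<^sup>2"
  have Y: "y \<bullet> y \<le> (1 - c)\<^sup>2 * X"
    using power_mono[OF assms(3), of 2] by (simp add: power_mult_distrib power2_norm_eq_inner X_def)
  have "x \<bullet> y \<le> norm x * norm y" by (rule norm_cauchy_schwarz)
  also have "\<dots> \<le> norm x * ((1 - c) * norm x)"
    using assms(3) by (rule mult_left_mono) simp
  finally have XY: "x \<bullet> y \<le> (1 - c) * X" by (simp add: X_def power2_eq_square mult_ac)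
  have "(norm (c *\<^sub>R x + y))\<^sup>2 + c * (norm (c *\<^sub>R x + y - x))\<^sup>2
      = (c\<^sup>2 + c * (1 - c)\<^sup>2) * X + 2 * c\<^sup>2 * (x \<bullet> y) + (1 + c) * (y \<bullet> y)"
    unfolding X_def power2_norm_eq_inner
    by (simp add: inner_add_left inner_add_right inner_diff_left inner_diff_right
        inner_commute[of y x] power2_eq_square algebra_simps)
  also have "\<dots> \<le> (c\<^sup>2 + c * (1 - c)\<^sup>2) * X + 2 * c\<^sup>2 * ((1 - c) * X)
      + (1 + c) * ((1 - c)\<^sup>2 * X)"
    using XY Y assms(1) by (intro add_mono mult_left_mono) auto
  also have "\<dots> = X" by (simp add: power2_eq_square algebra_simps)
  finally show ?thesis by (simp add: X_def)
qed

text \<open>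
  The squared norms decrease along an orbit, hence converge, so the displacements tend to zero.
  By compactness the orbit has a limit point, which is then fixed by \<open>T\<close>. As \<open>T\<close> is a
  contraction, the distances of the orbit to this fixed point decrease, and they
  tend to zero along a subsequence; therefore they tend to zero.
\<close>
lemma convergent_funpow_averaged:
  fixes T :: "'a::euclidean_space \<Rightarrow> 'a"
  assumes lin: "linear T" and c: "0 < c"
    and decr: "\<And>x. (norm (T x))\<^sup>2 + c * (norm (T x - x))\<^sup>2 \<le> (norm x)\<^sup>2"
  shows "convergent (\<lambda>n. (T ^^ n) x)"
proof -
  define u where "u n = (T ^^ n) x" for n
  have u_Suc: "u (Suc n) = T (u n)" for n by (simp add: u_def)
  have nonexp: "norm (T z) \<le> norm z" for z
  proof -
    have "0 \<le> c * (norm (T z - z))\<^sup>2" using c by simp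
    with decr[of z] have "(norm (T z))\<^sup>2 \<le> (norm z)\<^sup>2" by linarith
    then show ?thesis by (rule power2_le_imp_le) simp
  qed
  have dec: "decseq (\<lambda>n. (norm (u n))\<^sup>2)"
    by (rule decseq_SucI) (simp add: u_Suc power_mono nonexp)
  have "\<exists>L. (\<lambda>n. (norm (u n))\<^sup>2) \<longlonglongrightarrow> L"
    by (rule decseq_convergent[OF dec, of 0]) (simp, rule exI)
  then obtain L where L: "(\<lambda>n. (norm (u n))\<^sup>2) \<longlonglongrightarrow> L" ..
  have "(\<lambda>n. ((norm (u n))\<^sup>2 - (norm (u (Suc n)))\<^sup>2) / c) \<longlonglongrightarrow> (L - L) / c"
    using c by (intro tendsto_intros L LIMSEQ_Suc[OF L]) auto
  then have gap: "(\<lambda>n. ((norm (u n))\<^sup>2 - (norm (u (Suc n)))\<^sup>2) / c) \<longlonglongrightarrow> 0" by simp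
  have "(\<lambda>n. (norm (T (u n) - u n))\<^sup>2) \<longlonglongrightarrow> 0"
  proof (rule tendsto_sandwich[OF _ _ tendsto_const gap])
    have "(norm (T (u n) - u n))\<^sup>2 \<le> ((norm (u n))\<^sup>2 - (norm (u (Suc n)))\<^sup>2) / c" for n
      unfolding pos_le_divide_eq[OF c] u_Suc using decr[of "u n"] by (simp add: mult.commute)
    then show "\<forall>\<^sub>F n in sequentially. (norm (T (u n) - u n))\<^sup>2
        \<le> ((norm (u n))\<^sup>2 - (norm (u (Suc n)))\<^sup>2) / c"
      by (intro always_eventually allI)
  qed simp
  then have "(\<lambda>n. norm (T (u n) - u n)) \<longlonglongrightarrow> 0"
    by simp
  then have step: "(\<lambda>n. T (u n) - u n) \<longlonglongrightarrow> 0"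
    by (rule tendsto_norm_zero_cancel)
  have "norm (u n) \<le> norm x" for n
    by (induction n) (auto simp: u_Suc u_def intro: order_trans[OF nonexp])
  then have "bounded (range u)" unfolding bounded_iff by blast
  then obtain y r where r: "strict_mono r" and y: "(u \<circ> r) \<longlonglongrightarrow> y"
    using bounded_imp_convergent_subsequence by blast
  have "(\<lambda>n. T ((u \<circ> r) n) - (u \<circ> r) n) \<longlonglongrightarrow> T y - y"
    using lin by (intro tendsto_intros y bounded_linear.tendsto[of T])
      (simp add: linear_conv_bounded_linear)
  moreover have "(\<lambda>n. T ((u \<circ> r) n) - (u \<circ> r) n) \<longlonglongrightarrow> 0"
    using LIMSEQ_subseq_LIMSEQ[OF step r] by (simp add: o_def)
  ultimately have fix_y: "T y = y" using LIMSEQ_unique by fastforce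
  have "decseq (\<lambda>n. norm (u n - y))"
  proof (rule decseq_SucI)
    fix n
    have "u (Suc n) - y = T (u n - y)" by (simp add: u_Suc linear_diff[OF lin] fix_y)
    then show "norm (u (Suc n) - y) \<le> norm (u n - y)" by (simp add: nonexp)
  qed
  from decseq_convergent[OF this, of 0]
  obtain M where M: "(\<lambda>n. norm (u n - y)) \<longlonglongrightarrow> M" by fastforce
  have "(\<lambda>n. norm ((u \<circ> r) n - y)) \<longlonglongrightarrow> 0"
    by (rule tendsto_norm_zero[OF LIM_zero[OF y]])
  moreover have "(\<lambda>n. norm ((u \<circ> r) n - y)) \<longlonglongrightarrow> M"
    using LIMSEQ_subseq_LIMSEQ[OF M r] by (simp only: o_def)
  ultimately have "M = 0" by (rule LIMSEQ_unique[symmetric])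
  have "u \<longlonglongrightarrow> y"
    by (rule LIM_zero_cancel[OF tendsto_norm_zero_cancel[OF M[unfolded \<open>M = 0\<close>]]])
  then show ?thesis unfolding u_def convergent_def by blast
qed

lemma norm_vec_permute:
  fixes x :: "complex ^ 'i::finite"
  assumes "bij \<sigma>"
  shows "norm (\<chi> p. x $ \<sigma> p) = norm x"
  unfolding norm_vec_def L2_set_def
  using sum.reindex_bij_betw[OF assms, of "\<lambda>p. (norm (x $ p))\<^sup>2"] by simp

text \<open>
  Young's inequality for convolution, \<open>|f \<star> x|\<^sub>2 \<le> |f|\<^sub>1 |x|\<^sub>2\<close>, holds because \<open>f \<star> x\<close> is a
  combination of translates of \<open>x\<close>; only the fact that translations permute the coordinates matters.
\<close>
lemma norm_combination_permute_le:
  fixes x :: "complex ^ 'i::finite"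
  assumes "\<And>g. bij (\<sigma> g)"
  shows "norm (\<chi> p. \<Sum>g\<in>A. f g * x $ \<sigma> g p) \<le> (\<Sum>g\<in>A. norm (f g)) * norm x"
proof -
  have "(\<chi> p. \<Sum>g\<in>A. f g * x $ \<sigma> g p) = (\<Sum>g\<in>A. f g *s (\<chi> p. x $ \<sigma> g p))"
    by (simp add: vec_eq_iff)
  also have "norm \<dots> \<le> (\<Sum>g\<in>A. norm (f g) * norm x)"
  proof (rule sum_norm_le)
    fix g
    have "norm (f g *s (\<chi> p. x $ \<sigma> g p)) = norm (f g) * norm (\<chi> p. x $ \<sigma> g p)"
      by (simp add: norm_vec_def norm_mult L2_set_right_distrib)
    then show "norm (f g *s (\<chi> p. x $ \<sigma> g p)) \<le> norm (f g) * norm x"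
      using norm_vec_permute[OF assms] by simp
  qed
  finally show ?thesis by (simp add: sum_distrib_right)
qed

section \<open>Characters of the cyclic group\<close>

lemma eta_pow_eq_cis:
  "eta_pow (x :: 'k::nontriv mod_ring) = cis (2 * pi / CARD('k)) powi to_int_mod_ring x"
  by (simp add: eta_pow_def cis_conv_exp field_simps)

lemma eta_powi_mod:
  "cis (2 * pi / CARD('k::nontriv)) powi (n mod int CARD('k))
    = cis (2 * pi / CARD('k)) powi n"
proof -
  let ?w = "cis (2 * pi / CARD('k))"
  have "?w powi int CARD('k) = 1"
    by (simp add: Complex.DeMoivre)
  then have "?w powi (int CARD('k) * (n div int CARD('k))) = 1"
    by (simp only: power_int_mult power_int_1_left)
  moreover have "?w powi n
      = ?w powi (int CARD('k) * (n div int CARD('k))) * ?w powi (n mod int CARD('k))"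
    by (subst power_int_add[symmetric]) simp_all
  ultimately show ?thesis by simp
qed

text \<open>
  The representative of \<open>x + y\<close> in \<open>{0..<k}\<close> is the sum of those of \<open>x\<close> and \<open>y\<close>, possibly reduced by \<open>k\<close>, and
  \<open>\<eta>\<^sup>k = 1\<close>.
\<close>
lemma eta_pow_add: "eta_pow (x + y) = eta_pow x * eta_pow y"
  by (simp add: eta_pow_eq_cis to_int_mod_ring_add eta_powi_mod power_int_add)

lemma eta_pow_0: "eta_pow 0 = 1"
  by (simp add: eta_pow_eq_cis)

lemma norm_eta_pow: "norm (eta_pow x) = 1"
  by (simp add: eta_pow_eq_cis norm_power_int)

lemma eta_pow_eq_1_iff: "eta_pow (x :: 'k::nontriv mod_ring) = 1 \<longleftrightarrow> x = 0"
proof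
  assume 1: "eta_pow x = 1"
  have range: "to_int_mod_ring x \<in> {0..<int CARD('k)}"
    using range_to_int_mod_ring[where 'a = 'k] by blast
  then obtain j where j: "to_int_mod_ring x = int j" "j < CARD('k)"
    by (metis atLeastLessThan_iff nonneg_int_cases of_nat_less_iff)
  have "exp (2 * of_real pi * \<i> * of_nat j / of_nat CARD('k)) = 1"
    using 1 by (simp add: eta_pow_def j exp_of_nat_mult[symmetric] mult_ac)
  then have "CARD('k) dvd j"
    by (subst (asm) complex_root_unity_eq_1) (auto simp: Suc_leI)
  with j show "x = 0"
    by (metis int_ops(1) nat_dvd_not_less neq0_conv to_int_mod_ring_hom.hom_0_iff)
qed (simp add: eta_pow_0)

text \<open>
  Orthogonality of characters: the substitution \<open>i \<mapsto> i + 1\<close> multiplies the sum by \<open>eta_pow x\<close>, which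
  differs from \<open>1\<close> for \<open>x \<noteq> 0\<close>.
\<close>
lemma sum_eta_pow:
  "(\<Sum>i\<in>UNIV. eta_pow (i * x)) = (if x = 0 then of_nat CARD('k) else 0)"
  for x :: "'k::nontriv mod_ring"
proof (cases "x = 0")
  case False
  have bij: "bij (\<lambda>i. i + 1 :: 'k mod_ring)"
    by (rule bij_betw_byWitness[where f' = "\<lambda>i. i - 1"]) auto
  have "(\<Sum>i\<in>UNIV. eta_pow (i * x)) = (\<Sum>i\<in>UNIV. eta_pow ((i + 1) * x))"
    using sum.reindex_bij_betw[OF bij, of "\<lambda>i. eta_pow (i * x)"] by simp
  also have "\<dots> = (\<Sum>i\<in>UNIV. eta_pow (i * x)) * eta_pow x"
    by (simp add: distrib_right eta_pow_add sum_distrib_right)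
  finally show ?thesis using False eta_pow_eq_1_iff[of x] by simp
qed (simp add: eta_pow_0)

section \<open>Functionals and convolution in coordinates\<close>

lemma tensor_fun_basis:
  "tensor_fun \<mu> \<nu> (sek_tensor (sek_basis p) (sek_basis q)) = \<mu> (sek_basis p) * \<nu> (sek_basis q)"
proof -
  have "tensor_fun \<mu> \<nu> (sek_tensor (sek_basis p) (sek_basis q))
      = (\<Sum>p'\<in>UNIV. \<Sum>q'\<in>UNIV. if p' = p \<and> q' = q then \<mu> (sek_basis p') * \<nu> (sek_basis q') else 0)"
    unfolding tensor_fun_def by (intro sum.cong refl) (auto simp: sek_tensor_def sek_coord_basis)
  also have "\<dots> = (\<Sum>p'\<in>UNIV. if p' = p then \<mu> (sek_basis p) * \<nu> (sek_basis q) else 0)"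
    by (intro sum.cong refl) (simp cong: if_cong)
  finally show ?thesis by simp
qed

lemma sek_basis_Inl: "sek_basis (Inl (i, j)) = sek_d i j"
  and sek_basis_Inr: "sek_basis (Inr (i, j)) = sek_e i j"
  by (simp_all add: sek_basis_def)

lemma tensor_fun_add: "tensor_fun \<mu> \<nu> (s + t) = tensor_fun \<mu> \<nu> s + tensor_fun \<mu> \<nu> t"
  by (simp add: tensor_fun_def distrib_right sum.distrib)

lemma tensor_fun_scale: "tensor_fun \<mu> \<nu> (c *s t) = c * tensor_fun \<mu> \<nu> t"
  by (simp add: tensor_fun_def sum_distrib_left mult_ac)

lemma tensor_fun_sum: "tensor_fun \<mu> \<nu> (\<Sum>x\<in>A. f x) = (\<Sum>x\<in>A. tensor_fun \<mu> \<nu> (f x))"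
  by (induction A rule: infinite_finite_induct)
    (simp_all add: tensor_fun_add, simp_all add: tensor_fun_def)

lemmas tensor_fun_sek_basis =
  tensor_fun_basis[of _ _ "Inl (i, j)" "Inl (m, n)" for i j m n, unfolded sek_basis_Inl sek_basis_Inr]
  tensor_fun_basis[of _ _ "Inl (i, j)" "Inr (m, n)" for i j m n, unfolded sek_basis_Inl sek_basis_Inr]
  tensor_fun_basis[of _ _ "Inr (i, j)" "Inl (m, n)" for i j m n, unfolded sek_basis_Inl sek_basis_Inr]
  tensor_fun_basis[of _ _ "Inr (i, j)" "Inr (m, n)" for i j m n, unfolded sek_basis_Inl sek_basis_Inr]

lemma sek_conv_expand:
  "sek_conv \<mu> \<nu> a = (\<Sum>i\<in>UNIV. \<Sum>j\<in>UNIV. dual_d i j a * tensor_fun \<mu> \<nu> (delta_d i j))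
     + (\<Sum>i\<in>UNIV. \<Sum>j\<in>UNIV. dual_e i j a * tensor_fun \<mu> \<nu> (delta_e i j))"
  by (simp add: sek_conv_def sek_comult_def tensor_fun_add tensor_fun_scale tensor_fun_sum)

definition sek_functional :: "('k sek_idx \<Rightarrow> complex) \<Rightarrow> 'k::nontriv sekine \<Rightarrow> complex" where
  "sek_functional c = (\<lambda>a. \<Sum>p\<in>UNIV. sek_coord p a * c p)"

lemma sek_functional_in_dual: "sek_functional c \<in> sek_dual"
proof -
  have "Vector_Spaces.linear sek_scale (*) (sek_functional c)"
    unfolding Vector_Spaces.linear_iff
    by (intro conjI allI vector_space_sek_scale vector_space_complex_mult)
      (simp_all add: sek_functional_def sek_coord_add sek_coord_scale distrib_right distrib_left
        sum.distrib sum_distrib_left mult_ac)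
  then show ?thesis by (simp add: sek_dual_def)
qed

lemma sum_sek_idx:
  "(\<Sum>p\<in>UNIV. f (p :: 'k::nontriv sek_idx))
    = (\<Sum>i\<in>UNIV. \<Sum>j\<in>UNIV. f (Inl (i, j))) + (\<Sum>i\<in>UNIV. \<Sum>j\<in>UNIV. f (Inr (i, j)))"
  by (simp add: UNIV_Plus_UNIV[symmetric] sum.Plus sum.cartesian_product del: UNIV_Plus_UNIV)

lemma sek_conv_in_dual: "sek_conv \<mu> \<nu> \<in> sek_dual"
proof -
  have "sek_conv \<mu> \<nu> = sek_functional
      (case_sum (\<lambda>(i, j). tensor_fun \<mu> \<nu> (delta_d i j)) (\<lambda>(i, j). tensor_fun \<mu> \<nu> (delta_e i j)))"
    by (rule ext) (simp add: sek_functional_def sum_sek_idx sek_conv_expand sek_coord_def)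
  then show ?thesis by (simp add: sek_functional_in_dual)
qed

lemma sek_conv_pow_in_dual:
  "\<mu> \<in> sek_dual \<Longrightarrow> sek_conv_pow \<mu> n \<in> sek_dual"
  by (cases "n - 1") (simp_all add: sek_conv_pow_def sek_conv_in_dual)

text \<open>
  Evaluating \<open>\<phi> \<otimes> \<mu>\<close> on \<open>\<Delta>(d\<^sub>i\<^sub>j)\<close> here, and on \<open>\<Delta>(e\<^sub>i\<^sub>j)\<close> in the next lemma, reduces convolution to
  finite sums of products of coefficients.
\<close>
lemma sek_conv_d:
  "sek_conv \<phi> \<mu> (sek_d i j) =
     (\<Sum>m\<in>UNIV. \<Sum>n\<in>UNIV. \<phi> (sek_d m n) * \<mu> (sek_d (i - m) (j - n)))
     + (1 / of_nat CARD('k)) * (\<Sum>m\<in>UNIV. \<Sum>n\<in>UNIV.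
          eta_pow (i * (m - n)) * (\<phi> (sek_e m n) * \<mu> (sek_e (m + j) (n + j))))"
  for i j :: "'k::nontriv mod_ring"
proof -
  have "sek_conv \<phi> \<mu> (sek_d i j) = tensor_fun \<phi> \<mu> (delta_d i j)"
  proof -
    have "(\<Sum>a\<in>UNIV. \<Sum>b\<in>UNIV. dual_d a b (sek_d i j) * tensor_fun \<phi> \<mu> (delta_d a b))
        = (\<Sum>a\<in>UNIV. \<Sum>b\<in>UNIV. if b = j then if a = i then tensor_fun \<phi> \<mu> (delta_d i j) else 0 else 0)"
      by (intro sum.cong refl) (auto simp: dual_d_def sek_d_def axis_def)
    then show ?thesis
      by (simp add: sek_conv_expand) (simp add: dual_e_def sek_d_def)
  qed
  then show ?thesis
    by (simp add: delta_d_def tensor_fun_add tensor_fun_scale tensor_fun_sum tensor_fun_sek_basis)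
qed

lemma sek_conv_e:
  "sek_conv \<phi> \<mu> (sek_e i j) =
     (\<Sum>m\<in>UNIV. \<Sum>n\<in>UNIV. eta_pow (m * (i - j)) *
        (\<phi> (sek_d (- m) (- n)) * \<mu> (sek_e (i - n) (j - n))))
     + (\<Sum>m\<in>UNIV. \<Sum>n\<in>UNIV. eta_pow (m * (j - i)) *
          (\<phi> (sek_e (i - n) (j - n)) * \<mu> (sek_d m n)))"
  for i j :: "'k::nontriv mod_ring"
proof -
  have "sek_conv \<phi> \<mu> (sek_e i j) = tensor_fun \<phi> \<mu> (delta_e i j)"
  proof -
    have "(\<Sum>a\<in>UNIV. \<Sum>b\<in>UNIV. dual_e a b (sek_e i j) * tensor_fun \<phi> \<mu> (delta_e a b))
        = (\<Sum>a\<in>UNIV. \<Sum>b\<in>UNIV. if b = j then if a = i then tensor_fun \<phi> \<mu> (delta_e i j) else 0 else 0)"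
      by (intro sum.cong refl) (auto simp: dual_e_def sek_e_def axis_def)
    then show ?thesis
      by (simp add: sek_conv_expand) (simp add: dual_d_def sek_e_def)
  qed
  then show ?thesis
    by (simp add: delta_e_def tensor_fun_add tensor_fun_scale tensor_fun_sum tensor_fun_sek_basis)
qed

section \<open>The Fourier blocks of a functional\<close>

text \<open>
  The first half is the Fourier transform of \<open>i \<mapsto> \<phi> (sek_d i j)\<close> at the frequency \<open>l\<close>, the second half is
  the \<open>l\<close>-th diagonal of the matrix part. They belong together because the comultiplication
  pairs the character \<open>\<eta>\<^bsup>i(m - n)\<^esup>\<close> with \<open>e\<^sub>m\<^sub>n\<close>, so that only \<open>m - n = l\<close> contributes to the
  frequency \<open>l\<close>.
\<close>
definition sek_block ::
  "'k::nontriv mod_ring \<Rightarrow> ('k sekine \<Rightarrow> complex) \<Rightarrow> complex ^ ('k mod_ring + 'k mod_ring)" where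
  "sek_block l \<phi> = (\<chi> p. case p of
      Inl j \<Rightarrow> \<Sum>i\<in>UNIV. eta_pow (- (i * l)) * \<phi> (sek_d i j)
    | Inr i \<Rightarrow> \<phi> (sek_e i (i - l)))"

text \<open>
  The elements of the dihedral group of order \<open>2 k\<close> are the rotations \<open>Inl n\<close> and the reflections
  \<open>Inr m\<close>. The map \<open>dihedral g\<close> sends \<open>p\<close> to the \<open>q\<close> for which the product \<open>q \<cdot> g\<close>
  is \<open>p\<close>, where \<open>Inl a \<cdot> Inl b = Inl (a + b)\<close>, \<open>Inr a \<cdot> Inl b = Inr (a + b)\<close>,
  \<open>Inr a \<cdot> Inr b = Inl (b - a)\<close> and \<open>Inl a \<cdot> Inr b = Inr (b - a)\<close>.
\<close>
fun dihedral ::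
  "'k::nontriv mod_ring + 'k mod_ring \<Rightarrow> 'k mod_ring + 'k mod_ring \<Rightarrow> 'k mod_ring + 'k mod_ring" where
  "dihedral (Inl n) (Inl j) = Inl (j - n)"
| "dihedral (Inl n) (Inr i) = Inr (i - n)"
| "dihedral (Inr m) (Inl j) = Inr (m - j)"
| "dihedral (Inr m) (Inr i) = Inl (m - i)"

lemma bij_dihedral: "bij (dihedral g)"
proof (rule bij_betw_byWitness)
  \<comment> \<open>A rotation is undone by the opposite rotation, and a reflection is an involution.\<close>
  let ?inv = "case g of Inl n \<Rightarrow> dihedral (Inl (- n)) | Inr m \<Rightarrow> dihedral (Inr m)"
  show "\<forall>p\<in>UNIV. ?inv (dihedral g p) = p"
    by (cases g) (simp_all add: split_sum_all)
  show "\<forall>p\<in>UNIV. dihedral g (?inv p) = p"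
    by (cases g) (simp_all add: split_sum_all)
qed auto

lemma sum_UNIV_sum:
  "(\<Sum>p\<in>UNIV. f p) = (\<Sum>x\<in>UNIV. f (Inl x)) + (\<Sum>x\<in>UNIV. f (Inr x))"
  for f :: "'a::finite + 'b::finite \<Rightarrow> 'c::comm_monoid_add"
  by (simp add: UNIV_Plus_UNIV[symmetric] sum.Plus del: UNIV_Plus_UNIV)

lemma sum_rotate:
  "(\<Sum>i\<in>A. \<Sum>m\<in>B. \<Sum>n\<in>C. f i m n) = (\<Sum>m\<in>B. \<Sum>n\<in>C. \<Sum>i\<in>A. f i m n)"
  by (subst sum.swap) (rule sum.cong[OF refl], rule sum.swap)

lemma sum_diff_shift: "(\<Sum>x\<in>UNIV. f (x - c)) = (\<Sum>x\<in>UNIV. f x)"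
  for f :: "'k::nontriv mod_ring \<Rightarrow> 'b::comm_monoid_add"
  by (rule sum.reindex_bij_witness[of _ "\<lambda>x. x + c" "\<lambda>x. x - c"]) auto

lemma sum_diff_flip: "(\<Sum>x\<in>UNIV. f (c - x)) = (\<Sum>x\<in>UNIV. f x)"
  for f :: "'k::nontriv mod_ring \<Rightarrow> 'b::comm_monoid_add"
  by (rule sum.reindex_bij_witness[of _ "\<lambda>x. c - x" "\<lambda>x. c - x"]) auto

text \<open>
  Each of the four terms of the comultiplication yields one of the four cases of \<^const>\<open>dihedral\<close>. The
  Fourier transform turns the convolution of the \<open>d\<close>-parts in their first index into a product and
  leaves the one in the second index. For the product of two matrix parts, the transform in \<open>i\<close>
  of \<open>\<eta>\<^bsup>i(m - n)\<^esup>\<close> selects the diagonal \<open>m - n = l\<close>, and the factor \<open>1 / k\<close> normalises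
  it. In the mixed terms the sum over \<open>m\<close> is the transform at \<open>l\<close>, because \<open>e\<^sub>i\<^sub>j\<close> with \<open>i - j = l\<close> is
  accompanied by \<open>\<eta>\<^bsup>ml\<^esup>\<close> and \<open>d\<^bsub>-m,-n\<^esub>\<close>, or by \<open>\<eta>\<^bsup>-ml\<^esup>\<close> and \<open>d\<^bsub>m,n\<^esub>\<close>.
\<close>
lemma sek_block_conv:
  "sek_block l (sek_conv \<phi> \<mu>)
    = (\<chi> p. \<Sum>g\<in>UNIV. sek_block l \<mu> $ g * sek_block l \<phi> $ dihedral g p)"
  (is "?L = ?R") for l :: "'k::nontriv mod_ring"
proof (rule vec_eq_iff[THEN iffD2], rule allI)
  fix p :: "'k mod_ring + 'k mod_ring"
  let ?B = "\<lambda>\<phi> j. \<Sum>i\<in>UNIV. eta_pow (- (i * l)) * \<phi> (sek_d i j)"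
  show "?L $ p = ?R $ p"
  proof (cases p)
    case p: (Inl j)
    have "(\<Sum>i\<in>UNIV. eta_pow (- (i * l)) *
            (\<Sum>m\<in>UNIV. \<Sum>n\<in>UNIV. \<phi> (sek_d m n) * \<mu> (sek_d (i - m) (j - n))))
        = (\<Sum>n\<in>UNIV. \<Sum>m\<in>UNIV. \<Sum>i\<in>UNIV. (eta_pow (- (m * l)) * \<phi> (sek_d m n)) *
              (eta_pow (- ((i - m) * l)) * \<mu> (sek_d (i - m) (j - n))))"
      (is "_ = (\<Sum>n\<in>UNIV. \<Sum>m\<in>UNIV. \<Sum>i\<in>UNIV. ?t n m i)")
    proof -
      have t: "eta_pow (- (i * l)) * (\<phi> (sek_d m n) * \<mu> (sek_d (i - m) (j - n))) = ?t n m i" for i m n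
      proof -
        have "eta_pow (- (i * l)) = eta_pow (- (m * l)) * eta_pow (- ((i - m) * l))"
          by (simp add: eta_pow_add[symmetric] algebra_simps)
        then show ?thesis by (simp only: mult_ac)
      qed
      show ?thesis
        unfolding sum_distrib_left t
        by (subst sum_rotate) (rule sum.swap)
    qed
    also have "\<dots> = (\<Sum>n\<in>UNIV. ?B \<phi> n * ?B \<mu> (j - n))"
      by (simp add: sum_distrib_left[symmetric] sum_distrib_right[symmetric]
          sum_diff_shift[of "\<lambda>i. eta_pow (- (i * l)) * \<mu> (sek_d i _)"])
    also have "\<dots> = (\<Sum>n\<in>UNIV. ?B \<mu> n * ?B \<phi> (j - n))"
      using sum_diff_flip[of "\<lambda>n. ?B \<mu> n * ?B \<phi> (j - n)" j] by (simp add: mult.commute)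
    finally have 1: "(\<Sum>i\<in>UNIV. eta_pow (- (i * l)) *
            (\<Sum>m\<in>UNIV. \<Sum>n\<in>UNIV. \<phi> (sek_d m n) * \<mu> (sek_d (i - m) (j - n)))) = \<dots>" .
    have "(\<Sum>i\<in>UNIV. eta_pow (- (i * l)) * ((1 / of_nat CARD('k)) * (\<Sum>m\<in>UNIV. \<Sum>n\<in>UNIV.
          eta_pow (i * (m - n)) * (\<phi> (sek_e m n) * \<mu> (sek_e (m + j) (n + j))))))
       = (\<Sum>i\<in>UNIV. \<Sum>m\<in>UNIV. \<Sum>n\<in>UNIV. eta_pow (i * (m - n - l)) *
            (\<phi> (sek_e m n) * \<mu> (sek_e (m + j) (n + j)) / of_nat CARD('k)))"
    proof -
      have t: "eta_pow (- (i * l)) * ((1 / of_nat CARD('k)) * (eta_pow (i * (m - n)) * z))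
          = eta_pow (i * (m - n - l)) * (z / of_nat CARD('k))" for i m n z
      proof -
        have "eta_pow (i * (m - n - l)) = eta_pow (- (i * l)) * eta_pow (i * (m - n))"
          by (simp add: eta_pow_add[symmetric] algebra_simps)
        then show ?thesis by simp
      qed
      show ?thesis unfolding sum_distrib_left t ..
    qed
    also have "\<dots> = (\<Sum>m\<in>UNIV. \<Sum>n\<in>UNIV. (\<Sum>i\<in>UNIV. eta_pow (i * (m - n - l))) *
            (\<phi> (sek_e m n) * \<mu> (sek_e (m + j) (n + j)) / of_nat CARD('k)))"
      by (subst sum_rotate) (simp only: sum_distrib_right)
    also have "\<dots> = (\<Sum>m\<in>UNIV. \<Sum>n\<in>UNIV. if n = m - l then \<phi> (sek_e m n) * \<mu> (sek_e (m + j) (n + j)) else 0)"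
      by (intro sum.cong refl) (auto simp: sum_eta_pow)
    also have "\<dots> = (\<Sum>m\<in>UNIV. \<phi> (sek_e m (m - l)) * \<mu> (sek_e (m + j) (m + j - l)))"
      by (simp add: diff_add_eq)
    also have "\<dots> = (\<Sum>m\<in>UNIV. \<mu> (sek_e m (m - l)) * \<phi> (sek_e (m - j) (m - j - l)))"
      using sum_diff_shift[of "\<lambda>m. \<phi> (sek_e m (m - l)) * \<mu> (sek_e (m + j) (m + j - l))" j]
      by (simp add: mult.commute)
    finally have 2: "(\<Sum>i\<in>UNIV. eta_pow (- (i * l)) * ((1 / of_nat CARD('k)) * (\<Sum>m\<in>UNIV. \<Sum>n\<in>UNIV.
          eta_pow (i * (m - n)) * (\<phi> (sek_e m n) * \<mu> (sek_e (m + j) (n + j)))))) = \<dots>" .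
    show ?thesis
      unfolding p sek_block_def sum_UNIV_sum using 1 2
      by (simp add: sek_conv_d distrib_left sum.distrib)
  next
    case p: (Inr i)
    have "(\<Sum>m\<in>UNIV. \<Sum>n\<in>UNIV. eta_pow (m * l) *
          (\<phi> (sek_d (- m) (- n)) * \<mu> (sek_e (i - n) (i - l - n))))
        = (\<Sum>n\<in>UNIV. \<mu> (sek_e (i - n) (i - n - l)) *
            (\<Sum>m\<in>UNIV. eta_pow (m * l) * \<phi> (sek_d (- m) (- n))))"
      by (subst sum.swap) (simp add: sum_distrib_left algebra_simps)
    also have "\<dots> = (\<Sum>n\<in>UNIV. \<mu> (sek_e (i - n) (i - n - l)) * ?B \<phi> (- n))"
      using sum_diff_flip[of "\<lambda>m. eta_pow (- (m * l)) * \<phi> (sek_d m _)" 0] by simp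
    also have "\<dots> = (\<Sum>m\<in>UNIV. \<mu> (sek_e m (m - l)) * ?B \<phi> (m - i))"
      using sum_diff_flip[of "\<lambda>m. \<mu> (sek_e m (m - l)) * ?B \<phi> (m - i)" i] by simp
    finally have 1: "(\<Sum>m\<in>UNIV. \<Sum>n\<in>UNIV. eta_pow (m * l) *
          (\<phi> (sek_d (- m) (- n)) * \<mu> (sek_e (i - n) (i - l - n)))) = \<dots>" .
    have 2: "(\<Sum>m\<in>UNIV. \<Sum>n\<in>UNIV. eta_pow (m * - l) *
          (\<phi> (sek_e (i - n) (i - l - n)) * \<mu> (sek_d m n)))
        = (\<Sum>n\<in>UNIV. ?B \<mu> n * \<phi> (sek_e (i - n) (i - n - l)))"
      by (subst sum.swap) (simp add: sum_distrib_left sum_distrib_right algebra_simps)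
    show ?thesis
      unfolding p sek_block_def sum_UNIV_sum using 1 2
      by (simp add: sek_conv_e)
  qed
qed

text \<open>Fourier inversion; with the next lemma, the blocks of a functional determine it.\<close>
lemma sek_d_eq_sum_block:
  "\<phi> (sek_d i j) = (\<Sum>l\<in>UNIV. eta_pow (i * l) * sek_block l \<phi> $ Inl j) / of_nat CARD('k)"
  for i :: "'k::nontriv mod_ring"
proof -
  have "(\<Sum>l\<in>UNIV. eta_pow (i * l) * sek_block l \<phi> $ Inl j)
      = (\<Sum>l\<in>UNIV. \<Sum>m\<in>UNIV. eta_pow (l * (i - m)) * \<phi> (sek_d m j))"
    by (simp add: sek_block_def sum_distrib_left mult.assoc[symmetric] eta_pow_add[symmetric]
        algebra_simps)
  also have "\<dots> = (\<Sum>m\<in>UNIV. (\<Sum>l\<in>UNIV. eta_pow (l * (i - m))) * \<phi> (sek_d m j))"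
    by (subst sum.swap) (simp only: sum_distrib_right)
  also have "\<dots> = (\<Sum>m\<in>UNIV. if i = m then of_nat CARD('k) * \<phi> (sek_d m j) else 0)"
    by (intro sum.cong refl) (simp add: sum_eta_pow)
  finally show ?thesis by simp
qed

lemma sek_e_eq_block: "\<phi> (sek_e i j) = sek_block (i - j) \<phi> $ Inr i"
  by (simp add: sek_block_def)

section \<open>States\<close>

lemma sek_state_d_nonneg:
  assumes "sek_state \<mu>"
  shows "0 \<le> \<mu> (sek_d i j)"
proof -
  have "sek_mult (sek_star (sek_d i j)) (sek_d i j) = sek_d i j"
    by (auto simp: sek_mult_def sek_star_def sek_d_def vec_eq_iff axis_def matrix_matrix_mult_def)
  moreover have "0 \<le> \<mu> (sek_mult (sek_star (sek_d i j)) (sek_d i j))"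
    using assms unfolding sek_state_def by blast
  ultimately show ?thesis by simp
qed

text \<open>
  Positivity of the matrix \<open>\<mu> (sek_e r s)\<close>, obtained from elements \<open>a\<^sup>* a\<close> where \<open>a\<close> is a matrix with
  a single nonzero row \<open>w\<close>; the row number \<open>0\<close> is an arbitrary choice.
\<close>
lemma sek_state_quadratic_form_nonneg:
  assumes "sek_state \<mu>"
  shows "0 \<le> (\<Sum>r\<in>UNIV. \<Sum>s\<in>UNIV. cnj (w r) * w s * \<mu> (sek_e r s))"
proof -
  have dual: "\<mu> \<in> sek_dual" using assms by (simp add: sek_state_def)
  let ?a = "(0, \<chi> t r. if t = 0 then w r else 0) :: 'a sekine"
  have "cnj (if t = 0 then w r else 0) * (if t = 0 then w s else 0)
      = (if t = 0 then cnj (w r) * w s else 0)" for r s t :: "'a mod_ring"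
    by simp
  then have ent: "sek_mult (sek_star ?a) ?a = (0, \<chi> r s. cnj (w r) * w s)"
    by (simp add: sek_mult_def sek_star_def vec_eq_iff matrix_matrix_mult_def)
  have "\<mu> (sek_mult (sek_star ?a) ?a) = (\<Sum>r\<in>UNIV. \<Sum>s\<in>UNIV. cnj (w r) * w s * \<mu> (sek_e r s))"
    unfolding ent sek_dual_expand[OF dual, of "(0, _)"]
    by (simp add: sum_sek_idx sek_coord_def dual_d_def dual_e_def sek_basis_Inr)
  moreover have "0 \<le> \<mu> (sek_mult (sek_star ?a) ?a)"
    using assms unfolding sek_state_def by blast
  ultimately show ?thesis by simp
qed

text \<open>
  The \<open>2 \<times> 2\<close> minors of a positive semidefinite matrix give \<open>|\<kappa>\<^sub>r\<^sub>s|\<^sup>2 \<le> \<kappa>\<^sub>r\<^sub>r \<kappa>\<^sub>s\<^sub>s\<close>; the weaker bound by the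
  arithmetic mean is all that summation along a diagonal requires. It follows by testing
  the quadratic form on \<open>(1, z)\<close> with \<open>|z| = 1\<close>.
\<close>
lemma sek_state_norm_e_le:
  assumes "sek_state \<mu>"
  shows "norm (\<mu> (sek_e r s)) \<le> (Re (\<mu> (sek_e r r)) + Re (\<mu> (sek_e s s))) / 2"
proof -
  let ?\<kappa> = "\<lambda>a b. \<mu> (sek_e a b)"
  have pos: "0 \<le> ?\<kappa> r r + z * ?\<kappa> r s + cnj z * ?\<kappa> s r + z * cnj z * ?\<kappa> s s" for z
  proof -
    let ?w = "\<lambda>a. of_bool (a = r) + z * of_bool (a = s)"
    have cnj_of_bool: "cnj (of_bool P) = of_bool P" for P
      by (simp add: of_bool_def)
    have pick: "(\<Sum>b\<in>UNIV. (of_bool (b = r) + c * of_bool (b = s)) * x b) = x r + c * x s"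
      for c :: complex and x
    proof -
      have "(of_bool (b = r) + c * of_bool (b = s)) * x b
          = (if b = r then x r else 0) + (if b = s then c * x s else 0)" for b
        by (simp add: distrib_right)
      then show ?thesis by (simp only: sum.distrib sum.delta finite_UNIV if_True UNIV_I) simp
    qed
    have "(\<Sum>a\<in>UNIV. \<Sum>b\<in>UNIV. cnj (?w a) * ?w b * ?\<kappa> a b)
        = (\<Sum>a\<in>UNIV. (of_bool (a = r) + cnj z * of_bool (a = s)) * (\<Sum>b\<in>UNIV. ?w b * ?\<kappa> a b))"
      by (simp add: sum_distrib_left mult.assoc cnj_of_bool)
    also have "\<dots> = ?\<kappa> r r + z * ?\<kappa> r s + cnj z * ?\<kappa> s r + z * cnj z * ?\<kappa> s s"
      unfolding pick by (simp add: algebra_simps)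
    finally show ?thesis using sek_state_quadratic_form_nonneg[OF assms, of ?w] by simp
  qed
  have diag: "Im (?\<kappa> r r) = 0" "Im (?\<kappa> s s) = 0"
    using pos[of 0] pos[of 1] pos[of "- 1"] by (simp_all add: less_eq_complex_def)
  \<comment> \<open>The form is real at \<open>z = 1\<close> and at \<open>z = \<i>\<close>, which makes the matrix Hermitian.\<close>
  have herm: "?\<kappa> s r = cnj (?\<kappa> r s)"
    using pos[of 1] pos[of \<i>] diag
    by (simp add: complex_eq_iff less_eq_complex_def)
  show ?thesis
  proof (cases "?\<kappa> r s = 0")
    case True
    then show ?thesis using pos[of 0] pos[of 1] herm
      by (simp add: less_eq_complex_def)
  next
    case False
    \<comment> \<open>The phase that makes the two mixed terms equal to minus the modulus.\<close>
    define z where "z = - cnj (?\<kappa> r s) / of_real (norm (?\<kappa> r s))"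
    have sq: "?\<kappa> r s * cnj (?\<kappa> r s) = of_real (norm (?\<kappa> r s)) * of_real (norm (?\<kappa> r s))"
      using complex_norm_square[of "?\<kappa> r s"] by (simp add: power2_eq_square)
    have z: "z * ?\<kappa> r s = - of_real (norm (?\<kappa> r s))"
      using False by (simp add: z_def mult.commute[of "cnj _"] sq)
    have zz: "z * cnj z = 1"
      using False by (simp add: z_def mult.commute[of "cnj _"] sq)
    have "cnj z * ?\<kappa> s r = cnj (z * ?\<kappa> r s)" by (simp add: herm)
    with pos[of z] show ?thesis unfolding z zz by (simp add: z less_eq_complex_def)
  qed
qed

lemma sek_state_total:
  assumes "sek_state \<mu>"
  shows "(\<Sum>i\<in>UNIV. \<Sum>j\<in>UNIV. Re (\<mu> (sek_d i j))) + (\<Sum>r\<in>UNIV. Re (\<mu> (sek_e r r))) = 1"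
proof -
  have dual: "\<mu> \<in> sek_dual" using assms by (simp add: sek_state_def)
  have "\<mu> sek_one = (\<Sum>i\<in>UNIV. \<Sum>j\<in>UNIV. \<mu> (sek_d i j)) + (\<Sum>r\<in>UNIV. \<mu> (sek_e r r))"
    unfolding sek_dual_expand[OF dual, of sek_one]
    by (simp add: sum_sek_idx sek_coord_def dual_d_def dual_e_def
        sek_one_def mat_def sek_basis_Inl sek_basis_Inr if_distrib[of "\<lambda>t. t * _"] cong: if_cong)
  then have "Re (\<mu> sek_one) = (\<Sum>i\<in>UNIV. \<Sum>j\<in>UNIV. Re (\<mu> (sek_d i j))) + (\<Sum>r\<in>UNIV. Re (\<mu> (sek_e r r)))"
    by simp
  then show ?thesis using assms by (simp add: sek_state_def)
qed

text \<open>
  The counit has the block \<open>of_bool (g = Inl 0)\<close>, so the left-hand side is the \<open>\<ell>\<^sup>1\<close>-norm of the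
  block of \<open>\<mu> - a \<epsilon>\<close>. The transform of nonnegative coefficients is bounded by their sum, and a
  diagonal of the matrix part by the trace; these bounds add up to \<open>\<mu> 1 - a\<close>.
\<close>
lemma sek_state_block_norm_le:
  assumes "sek_state \<mu>"
  defines "a \<equiv> Re (\<mu> (sek_d 0 0))"
  shows "(\<Sum>g\<in>UNIV. norm (sek_block l \<mu> $ g - of_bool (g = Inl 0) * of_real a)) \<le> 1 - a"
proof -
  have d_real: "\<mu> (sek_d i j) = of_real (Re (\<mu> (sek_d i j)))" for i j
    using sek_state_d_nonneg[OF assms(1)] by (simp add: complex_eq_iff less_eq_complex_def)
  have d_pos: "0 \<le> Re (\<mu> (sek_d i j))" for i j
    using sek_state_d_nonneg[OF assms(1)] by (simp add: less_eq_complex_def)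
  have "norm (sek_block l \<mu> $ Inl j - of_bool (j = 0) * of_real a)
      \<le> (\<Sum>i\<in>UNIV. Re (\<mu> (sek_d i j)) - (if i = 0 then of_bool (j = 0) * a else 0))" for j
  proof -
    \<comment> \<open>Subtracting \<open>a\<close> inside the sum cancels the summand \<open>i = j = 0\<close> exactly, as its character is \<open>1\<close>.\<close>
    have "sek_block l \<mu> $ Inl j - of_bool (j = 0) * of_real a
        = (\<Sum>i\<in>UNIV. eta_pow (- (i * l)) * \<mu> (sek_d i j)
            - (if i = 0 then of_bool (j = 0) * of_real a else 0))"
      by (simp add: sek_block_def sum_subtractf)
    also have "norm \<dots> \<le> (\<Sum>i\<in>UNIV. Re (\<mu> (sek_d i j)) - (if i = 0 then of_bool (j = 0) * a else 0))"
    proof (rule sum_norm_le)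
      fix i :: "'a mod_ring"
      have "norm (eta_pow (- (i * l)) * \<mu> (sek_d i j)) = Re (\<mu> (sek_d i j))"
        using d_real[of i j] d_pos[of i j]
        by (metis abs_of_nonneg mult_1 norm_eta_pow norm_mult norm_of_real)
      moreover have "eta_pow (- (0 * l)) * \<mu> (sek_d 0 0) - of_real a = 0"
        unfolding a_def by (simp add: eta_pow_0 d_real[symmetric])
      ultimately show "norm (eta_pow (- (i * l)) * \<mu> (sek_d i j)
            - (if i = 0 then of_bool (j = 0) * of_real a else 0))
          \<le> Re (\<mu> (sek_d i j)) - (if i = 0 then of_bool (j = 0) * a else 0)"
        by (auto simp: a_def)
    qed
    finally show ?thesis .
  qed
  then have "(\<Sum>j\<in>UNIV. norm (sek_block l \<mu> $ Inl j - of_bool (j = 0) * of_real a))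
      \<le> (\<Sum>j\<in>UNIV. \<Sum>i\<in>UNIV. Re (\<mu> (sek_d i j)) - (if i = 0 then of_bool (j = 0) * a else 0))"
    by (rule sum_mono)
  also have "\<dots> = (\<Sum>j\<in>UNIV. \<Sum>i\<in>UNIV. Re (\<mu> (sek_d i j))) - a"
    by (simp add: sum_subtractf of_bool_def if_distrib[of "\<lambda>t. t * _"] cong: if_cong)
  also have "(\<Sum>j\<in>UNIV. \<Sum>i\<in>UNIV. Re (\<mu> (sek_d i j))) = (\<Sum>i\<in>UNIV. \<Sum>j\<in>UNIV. Re (\<mu> (sek_d i j)))"
    by (rule sum.swap)
  finally have inl: "(\<Sum>j\<in>UNIV. norm (sek_block l \<mu> $ Inl j - of_bool (j = 0) * of_real a))
      \<le> (\<Sum>i\<in>UNIV. \<Sum>j\<in>UNIV. Re (\<mu> (sek_d i j))) - a" .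
  have "(\<Sum>i\<in>UNIV. norm (sek_block l \<mu> $ Inr i))
      \<le> (\<Sum>i\<in>UNIV. (Re (\<mu> (sek_e i i)) + Re (\<mu> (sek_e (i - l) (i - l)))) / 2)"
  proof (rule sum_mono)
    show "norm (sek_block l \<mu> $ Inr i)
        \<le> (Re (\<mu> (sek_e i i)) + Re (\<mu> (sek_e (i - l) (i - l)))) / 2" for i
      using sek_state_norm_e_le[OF assms(1), of i "i - l"] by (simp add: sek_block_def)
  qed
  also have "\<dots> = ((\<Sum>i\<in>UNIV. Re (\<mu> (sek_e i i))) + (\<Sum>i\<in>UNIV. Re (\<mu> (sek_e (i - l) (i - l))))) / 2"
    by (simp only: sum.distrib sum_divide_distrib[symmetric])
  also have "\<dots> = (\<Sum>i\<in>UNIV. Re (\<mu> (sek_e i i)))"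
    using sum_diff_shift[of "\<lambda>i. Re (\<mu> (sek_e i i))" l] by simp
  finally show ?thesis
    using inl sek_state_total[OF assms(1)] by (simp add: sum_UNIV_sum)
qed

section \<open>Convergence of the convolution powers\<close>

text \<open>
  The block of \<open>\<mu>\<^bsup>\<star>(n + 1)\<^esup>\<close> is \<open>T\<^sup>n\<close> applied to that of \<open>\<mu>\<close>, where \<open>T = a I + R\<close>: the part
  \<open>a I\<close> comes from \<open>dihedral (Inl 0)\<close>, which is the identity.
\<close>
lemma convergent_sek_block_conv_pow:
  assumes "sek_state \<mu>" and pos: "0 < Re (\<mu> (sek_d 0 0))"
  shows "convergent (\<lambda>n. sek_block l (sek_conv_pow \<mu> (Suc n)))"
proof -
  define a where "a = Re (\<mu> (sek_d 0 0))"
  define f where "f = sek_block l \<mu>"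
  define T where "T x = (\<chi> p. \<Sum>g\<in>UNIV. f $ g * x $ dihedral g p)"
    for x :: "complex ^ ('a mod_ring + 'a mod_ring)"
  define R where "R x = (\<chi> p. \<Sum>g\<in>UNIV. (f $ g - of_bool (g = Inl 0) * of_real a) * x $ dihedral g p)"
    for x :: "complex ^ ('a mod_ring + 'a mod_ring)"
  have "0 \<le> (\<Sum>g\<in>UNIV. norm (f $ g - of_bool (g = Inl 0) * of_real a))"
    by (simp add: sum_nonneg)
  also have le: "\<dots> \<le> 1 - a"
    unfolding f_def a_def by (rule sek_state_block_norm_le[OF assms(1)])
  finally have a1: "a \<le> 1" by simp
  have R: "norm (R x) \<le> (1 - a) * norm x" for x
    unfolding R_def
    by (rule order_trans[OF norm_combination_permute_le[OF bij_dihedral] mult_right_mono[OF le]]) simp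
  have T: "T x = a *\<^sub>R x + R x" for x
  proof -
    have d0: "dihedral (Inl 0) p = p" for p by (cases p) simp_all
    have "(\<Sum>g\<in>UNIV. of_bool (g = Inl 0) * of_real a * x $ dihedral g p) = of_real a * x $ p" for p
      by (simp add: of_bool_def if_distrib[of "\<lambda>t. t * _"] d0 cong: if_cong)
    then show ?thesis
      by (simp add: T_def R_def vec_eq_iff left_diff_distrib sum_subtractf
          scaleR_conv_of_real[where 'a = complex])
  qed
  have lin: "linear T"
    by (rule linearI) (simp_all add: T_def vec_eq_iff distrib_left sum.distrib scaleR_sum_right)
  have "sek_block l (sek_conv_pow \<mu> (Suc n)) = (T ^^ n) f" for n
  proof (induction n)
    case (Suc n)
    have "sek_block l (sek_conv_pow \<mu> (Suc (Suc n))) = T (sek_block l (sek_conv_pow \<mu> (Suc n)))"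
      by (simp add: sek_conv_pow_Suc sek_block_conv T_def f_def)
    with Suc show ?case by simp
  qed (simp add: sek_conv_pow_1 f_def)
  moreover have "convergent (\<lambda>n. (T ^^ n) f)"
  proof (rule convergent_funpow_averaged[OF lin, of a])
    show "(norm (T x))\<^sup>2 + a * (norm (T x - x))\<^sup>2 \<le> (norm x)\<^sup>2" for x
      unfolding T using pos a1 R by (intro averaged_contraction_norm) (auto simp: a_def)
  qed (use pos in \<open>simp add: a_def\<close>)
  ultimately show ?thesis by simp
qed

lemma convergent_basis_if_convergent_blocks:
  assumes "\<And>l. convergent (\<lambda>n. sek_block l (\<phi> n))"
  shows "convergent (\<lambda>n. \<phi> n (sek_basis p))"
proof -
  have comp: "convergent (\<lambda>n. sek_block l (\<phi> n) $ q)" for l q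
    using assms[of l] unfolding convergent_def by (metis tendsto_vec_nth)
  show ?thesis
  proof (cases p)
    case (Inl ij)
    then obtain i j where p: "p = Inl (i, j)" by (cases ij) auto
    show ?thesis
      unfolding p sek_basis_Inl sek_d_eq_sum_block divide_inverse
      by (intro convergent_mult convergent_sum convergent_const comp)
  next
    case (Inr ij)
    then obtain i j where "p = Inr (i, j)" by (cases ij) auto
    then show ?thesis by (simp add: sek_basis_Inr sek_e_eq_block comp)
  qed
qed

lemma tendsto_funI:
  fixes f :: "'b \<Rightarrow> 'i \<Rightarrow> 'a::topological_space"
  assumes "\<And>i. ((\<lambda>n. f n i) \<longlongrightarrow> l i) F"
  shows "(f \<longlongrightarrow> l) F"
proof -
  have "limitin (product_topology (\<lambda>_. euclidean) UNIV) f l F"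
    using assms by (simp add: limitin_componentwise)
  then show ?thesis by (simp add: euclidean_product_topology)
qed

text \<open>
  The limit is the linear functional whose values on the basis are the limits of the values; an arbitrary
  argument is a fixed combination of basis elements.
\<close>
lemma dual_tendsto_if_convergent_basis:
  assumes dual: "\<And>n. \<phi> n \<in> sek_dual"
    and "\<And>p. convergent (\<lambda>n. \<phi> n (sek_basis p))"
  shows "\<exists>\<nu>\<in>sek_dual. \<phi> \<longlonglongrightarrow> \<nu>"
proof -
  from assms(2) have "\<forall>p. \<exists>z. (\<lambda>n. \<phi> n (sek_basis p)) \<longlonglongrightarrow> z" by (simp add: convergent_def)
  then obtain c where c: "\<And>p. (\<lambda>n. \<phi> n (sek_basis p)) \<longlonglongrightarrow> c p" by metis
  have "\<phi> \<longlonglongrightarrow> sek_functional c"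
  proof (rule tendsto_funI)
    fix a
    show "(\<lambda>n. \<phi> n a) \<longlonglongrightarrow> sek_functional c a"
      unfolding sek_dual_expand[OF dual, of _ a] sek_functional_def by (intro tendsto_intros c)
  qed
  then show ?thesis using sek_functional_in_dual by blast
qed

theorem proposition4p1:
  fixes \<alpha> \<kappa> :: "'k::nontriv mod_ring \<Rightarrow> 'k mod_ring \<Rightarrow> complex"
    and \<mu> :: "'k sekine \<Rightarrow> complex"
  assumes "\<mu> = (\<lambda>a. (\<Sum>i\<in>UNIV. \<Sum>j\<in>UNIV. \<alpha> i j * dual_d i j a)
                    + (\<Sum>r\<in>UNIV. \<Sum>s\<in>UNIV. \<kappa> r s * dual_e r s a))"
    and "sek_state \<mu>"
    and "\<alpha> 0 0 > 0"
  shows "\<exists>\<nu>\<in>sek_dual. (\<lambda>n. sek_conv_pow \<mu> (Suc n)) \<longlonglongrightarrow> \<nu>"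
proof -
  have "\<alpha> i j * dual_d i j (sek_d 0 0) = (if j = 0 then if i = 0 then \<alpha> 0 0 else 0 else 0)" for i j
    by (auto simp: dual_d_def sek_d_def axis_def)
  then have "\<mu> (sek_d 0 0) = \<alpha> 0 0"
    unfolding assms(1) by (simp add: dual_e_def) (simp add: sek_d_def)
  with assms(3) have pos: "0 < Re (\<mu> (sek_d 0 0))"
    by (simp add: less_complex_def)
  show ?thesis
  proof (rule dual_tendsto_if_convergent_basis)
    show "sek_conv_pow \<mu> (Suc n) \<in> sek_dual" for n
      using assms(2) by (simp add: sek_state_def sek_conv_pow_in_dual)
    show "convergent (\<lambda>n. sek_conv_pow \<mu> (Suc n) (sek_basis p))" for p
      by (intro convergent_basis_if_convergent_blocks convergent_sek_block_conv_pow assms(2) pos)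
  qed
qed

end
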